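(* Let $n$ be a positive integer with $n\equiv 3 \pmod 4$. Then $va_3^{\equiv}(K_{n,n,n})\leq 3\left\lfloor \frac{n+1}{4}\right\rfloor$.
   Context: All graphs are finite and simple. A $t$-coloring of a graph $G$ is a map $f:V(G)\to\{1,\dots,t\}$, with color classes $V_i=\{v: f(v)=i\}$. It is equitable if $\big||V_i|-|V_j|\big|\le 1$ for all $i,j$. A $(t,k)$-tree-coloring of $G$ is a $t$-coloring such that every connected component of each induced subgraph $G[V_i]$ is a tree of maximum degree at most $k$; an equitable $(t,k)$-tree-coloring is a $(t,k)$-tree-coloring that is equitable. The strong equitable vertex $k$-arboricity $va_k^{\equiv}(G)$ is the smallest integer $t$ such that $G$ has an equitable $(t',k)$-tree-coloring for every integer $t'\ge t$. $K_{n,n,n}$ denotes the complete tripartite graph whose three partite sets each have exactly $n$ vertices. *)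

theory Defs
  imports "Graph_Theory.Digraph_Component" "HOL-Number_Theory.Cong" "HOL-Library.FuncSet"
begin

text \<open>
  A finite simple graph is a digraph satisfying the locale predicate \<^const>\<open>graph\<close>: each
  edge is a pair of opposite arcs, and the degree of a vertex is its out-degree.
\<close>

definition complete_tripartite_graph :: "nat \<Rightarrow> nat \<Rightarrow> nat \<Rightarrow> ('a, 'b) pre_digraph \<Rightarrow> bool" where
  "complete_tripartite_graph l m n G \<longleftrightarrow> graph G \<and> (\<exists>U V W. verts G = U \<union> V \<union> W
    \<and> U \<inter> V = {} \<and> U \<inter> W = {} \<and> V \<inter> W = {}
    \<and> card U = l \<and> card V = m \<and> card W = n
    \<and> arcs_ends G = U \<times> V \<union> V \<times> U \<union> U \<times> W \<union> W \<times> U \<union> V \<times> W \<union> W \<times> V)"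

text \<open>
  The library's \<^const>\<open>tree\<close> does not fit here: in a symmetric digraph every edge yields a
  directed cycle \<open>u, v, u\<close> of length 2. The cycles of the undirected simple graph are
  the directed cycles of length at least 3.
\<close>

definition undirected_tree :: "('a, 'b) pre_digraph \<Rightarrow> bool" where
  "undirected_tree G \<longleftrightarrow> connected G \<and> \<not> (\<exists>p. pre_digraph.cycle G p \<and> 3 \<le> length p)"

definition connected_component :: "('a, 'b) pre_digraph \<Rightarrow> ('a, 'b) pre_digraph \<Rightarrow> bool" where
  "connected_component H G \<longleftrightarrow> pre_digraph.max_subgraph G connected H"

definition coloring :: "('a, 'b) pre_digraph \<Rightarrow> nat \<Rightarrow> ('a \<Rightarrow> nat) \<Rightarrow> bool" where
  "coloring G t f \<longleftrightarrow> f \<in> verts G \<rightarrow> {1..t}"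

definition color_class :: "('a, 'b) pre_digraph \<Rightarrow> ('a \<Rightarrow> nat) \<Rightarrow> nat \<Rightarrow> 'a set" where
  "color_class G f i = {v \<in> verts G. f v = i}"

definition equitable :: "('a, 'b) pre_digraph \<Rightarrow> nat \<Rightarrow> ('a \<Rightarrow> nat) \<Rightarrow> bool" where
  "equitable G t f \<longleftrightarrow> (\<forall>i\<in>{1..t}. \<forall>j\<in>{1..t}.
     \<bar>int (card (color_class G f i)) - int (card (color_class G f j))\<bar> \<le> 1)"

definition tree_coloring :: "('a, 'b) pre_digraph \<Rightarrow> nat \<Rightarrow> nat \<Rightarrow> ('a \<Rightarrow> nat) \<Rightarrow> bool" where
  "tree_coloring G t k f \<longleftrightarrow> coloring G t f \<and>
     (\<forall>i\<in>{1..t}. \<forall>H. connected_component H (G \<restriction> color_class G f i) \<longrightarrow>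
        undirected_tree H \<and> (\<forall>v\<in>verts H. out_degree H v \<le> k))"

definition equitable_tree_coloring ::
    "('a, 'b) pre_digraph \<Rightarrow> nat \<Rightarrow> nat \<Rightarrow> ('a \<Rightarrow> nat) \<Rightarrow> bool" where
  "equitable_tree_coloring G t k f \<longleftrightarrow> tree_coloring G t k f \<and> equitable G t f"

text \<open>
  For a finite graph the minimum exists: if \<open>t\<close> is at least the number of vertices, an injective
  coloring is an equitable tree-coloring.
\<close>

definition strong_equitable_vertex_arboricity :: "nat \<Rightarrow> ('a, 'b) pre_digraph \<Rightarrow> nat" where
  "strong_equitable_vertex_arboricity k G =
     (LEAST t. \<forall>t'\<ge>t. \<exists>f. equitable_tree_coloring G t' k f)"

end

theory Submission
  imports Defs "HOL-Library.Multiset"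
begin

text \<open>
  A set of vertices all but one of which lie in a single partite set induces a star plus isolated
  vertices, so every component is a tree, of maximum degree at most 3 if the set has at most 4
  elements. Hence it suffices to partition the \<open>3n\<close> vertices into \<open>t\<close> such sets of nearly equal
  size. Let \<open>n = 4m - 1\<close>.

  If \<open>3m \<le> t \<le> n\<close>, put \<open>s = n - t\<close>. Then \<open>3s\<close> classes of size 4 and \<open>n - 4s \<ge> 3\<close> classes of
  size 3 are needed. Take \<open>s\<close> classes of size 4 from each partite set; of the remaining \<open>r = n - 4s\<close>
  vertices in each partite set, use triples inside the partite sets except for two mixed triples,
  which absorb the residue of \<open>r\<close> modulo 3.

  If \<open>n < t\<close> and \<open>2t \<le> 3n\<close>, the number \<open>3n - 2t\<close> of triples is smaller than \<open>n\<close> and of the same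
  parity as \<open>n\<close>, so all the triples fit inside the partite sets, and any pair is admissible. For
  larger \<open>t\<close> all classes have at most 2 elements and nothing needs to be arranged.
\<close>

subsection \<open>Star-like vertex sets\<close>

text \<open>The center \<open>c\<close> need not lie in \<open>S\<close>, so subsets of a part,
  including the empty set, need no separate case.\<close>

definition star_like :: "'a set set \<Rightarrow> 'a set \<Rightarrow> bool" where
  "star_like P S \<longleftrightarrow> (\<exists>c. \<exists>A\<in>P. S - {c} \<subseteq> A)"

lemma star_like_subset: "A \<in> P \<Longrightarrow> S \<subseteq> A \<Longrightarrow> star_like P S"
  unfolding star_like_def by blast

lemma star_like_insert: "A \<in> P \<Longrightarrow> S \<subseteq> A \<Longrightarrow> star_like P (insert c S)"
  unfolding star_like_def by blast

lemma star_like_card_le_2: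
  assumes "S \<subseteq> \<Union>P" "P \<noteq> {}" "finite S" "card S \<le> 2"
  shows "star_like P S"
proof (cases "S = {}")
  case True
  then show ?thesis using assms(2) by (auto simp: star_like_def)
next
  case False
  then obtain c where c: "c \<in> S" by blast
  then have "card (S - {c}) \<le> Suc 0" using assms by simp
  then have single: "x = y" if "x \<in> S - {c}" "y \<in> S - {c}" for x y
    using that assms(3) card_le_Suc0_iff_eq[of "S - {c}"] by blast
  show ?thesis
  proof (cases "S - {c} = {}")
    case True
    then show ?thesis using assms(2) unfolding star_like_def by blast
  next
    case False
    then obtain d where d: "d \<in> S - {c}" by blast
    then obtain A where "A \<in> P" "d \<in> A" using assms(1) by blast
    then have "S - {c} \<subseteq> A" using single d by blast
    then show ?thesis using \<open>A \<in> P\<close> unfolding star_like_def by blast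
  qed
qed

text \<open>For the first three arcs u-v, v-w, w-x of a cycle, the second forces \<open>c\<close> to
  be v or w; but the third avoids v and the first avoids w. The triangle is the case x = u.\<close>

lemma no_long_cycle_if_arcs_meet_vertex:
  assumes wf: "wf_digraph H"
    and meets: "\<And>e. e \<in> arcs H \<Longrightarrow> tail H e = c \<or> head H e = c"
    and cyc: "pre_digraph.cycle H p"
  shows "length p < 3"
proof (rule ccontr)
  interpret wf_digraph H by fact
  assume "\<not> length p < 3"
  then obtain e1 e2 e3 es where p: "p = e1 # e2 # e3 # es"
    by (auto simp: not_less numeral_3_eq_3 Suc_le_length_iff)
  from cyc obtain u where u: "awalk u p u" "distinct (tl (awalk_verts u p))"
    unfolding cycle_def by blast
  let ?vs = "awalk_verts (head H e3) es"
  have arcs: "e1 \<in> arcs H" "e2 \<in> arcs H" "e3 \<in> arcs H" and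
    ends: "tail H e1 = u" "head H e1 = tail H e2" "head H e2 = tail H e3" and
    cas: "cas (head H e3) es u"
    using u(1) by (auto simp: awalk_def p)
  \<comment> \<open>\<open>tl\<close> drops the starting vertex \<open>u\<close>, but
    \<open>u\<close> recurs at the end of the closed walk, so distinctness still separates it from
    the interior vertices.\<close>
  have "last ?vs = u" "hd ?vs = head H e3"
    using cas awlast_if_cas awhd_if_cas by blast+
  moreover have "?vs \<noteq> []" by (cases es) auto
  ultimately have "u \<in> set ?vs" "head H e3 \<in> set ?vs"
    by (metis last_in_set, metis hd_in_set)
  then have "u \<noteq> tail H e2" "u \<noteq> tail H e3" "tail H e2 \<noteq> tail H e3"
    "head H e3 \<noteq> tail H e2" "head H e3 \<noteq> tail H e3"
    using u(2) by (auto simp: p)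
  then show False
    using meets[OF arcs(1)] meets[OF arcs(2)] meets[OF arcs(3)] ends by auto
qed

text \<open>The heads of the arcs leaving \<open>v\<close> are pairwise distinct, as there are no
  parallel arcs, and differ from \<open>v\<close>, as there are no loops.\<close>

lemma out_degree_less_card_verts:
  assumes "digraph H" "v \<in> verts H"
  shows "out_degree H v < card (verts H)"
proof -
  interpret digraph H by fact
  have "inj_on (head H) (out_arcs H v)"
    by (rule inj_onI) (auto simp: arc_to_ends_def intro: no_multi_arcs)
  moreover have "head H ` out_arcs H v \<subseteq> verts H - {v}"
    using no_loops by (fastforce simp: out_arcs_def)
  ultimately have "card (out_arcs H v) \<le> card (verts H - {v})"
    by (metis card_image card_mono finite_Diff finite_verts)
  also have "\<dots> < card (verts H)"
    using assms(2) by (intro card_Diff1_less) auto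
  finally show ?thesis by (simp add: out_degree_def)
qed

text \<open>Apart from the center \<open>c\<close>, the set \<open>S\<close> lies in one independent
  part, so every arc of \<open>H\<close> meets \<open>c\<close>. The degree bound comes from the
  size of \<open>S\<close> alone.\<close>

lemma star_like_component:
  assumes G: "digraph G"
    and indep: "\<And>A e. A \<in> P \<Longrightarrow> e \<in> arcs G \<Longrightarrow> \<not> (tail G e \<in> A \<and> head G e \<in> A)"
    and S: "star_like P S" "S \<subseteq> verts G" "card S \<le> Suc k"
    and H: "connected_component H (G \<restriction> S)"
  shows "undirected_tree H \<and> (\<forall>v\<in>verts H. out_degree H v \<le> k)"
proof (intro conjI ballI)
  interpret digraph G by fact
  have sub: "subgraph H (G \<restriction> S)" and con: "connected H"
    using H by (auto simp: connected_component_def pre_digraph.max_subgraph_def)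
  have th: "tail H = tail G" "head H = head G" and
    HS: "verts H \<subseteq> S" "arcs H \<subseteq> {e \<in> arcs G. tail G e \<in> S \<and> head G e \<in> S}"
    and wf: "wf_digraph H"
    using sub by (auto simp: subgraph_def compatible_def)
  have fin: "finite S" using S(2) finite_verts finite_subset by blast
  obtain c A where "A \<in> P" "S - {c} \<subseteq> A" using S(1) by (auto simp: star_like_def)
  then have "tail H e = c \<or> head H e = c" if "e \<in> arcs H" for e
    using that indep[of A e] HS(2) th by auto
  then show "undirected_tree H"
    using con no_long_cycle_if_arcs_meet_vertex[OF wf, of c] by (fastforce simp: undirected_tree_def)
  have "finite (verts H)" "finite (arcs H)"
    using HS fin finite_arcs by (auto intro: finite_subset)
  then have "digraph H"
    using wf HS(2) th no_loops no_multi_arcs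
    by (auto simp: digraph_def fin_digraph_def fin_digraph_axioms_def loopfree_digraph_def
        loopfree_digraph_axioms_def nomulti_digraph_def nomulti_digraph_axioms_def
        arc_to_ends_def subset_iff)
  fix v assume "v \<in> verts H"
  then have "out_degree H v < card (verts H)"
    using \<open>digraph H\<close> by (intro out_degree_less_card_verts)
  also have "\<dots> \<le> card S" using HS(1) fin by (rule card_mono[rotated])
  finally show "out_degree H v \<le> k" using S(3) by simp
qed

subsection \<open>Tilings by star-like sets\<close>

text \<open>The multiset records the sizes of the tiles; empty tiles are allowed and counted.\<close>

inductive star_tiling :: "'a set set \<Rightarrow> 'a set \<Rightarrow> nat multiset \<Rightarrow> bool" for P where
  empty: "star_tiling P {} {#}"
| add: "star_tiling P X M \<Longrightarrow> finite S \<Longrightarrow> star_like P S \<Longrightarrow> S \<inter> X = {} \<Longrightarrow>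
    star_tiling P (S \<union> X) (add_mset (card S) M)"

lemma star_tiling_single:
  assumes "finite S" "star_like P S"
  shows "star_tiling P S {#card S#}"
  using add[OF empty assms] by simp

lemma star_tiling_union:
  assumes "star_tiling P X M" "star_tiling P Y N" "X \<inter> Y = {}"
  shows "star_tiling P (X \<union> Y) (M + N)"
  using assms
proof (induction rule: star_tiling.induct)
  case empty
  then show ?case by simp
next
  case (add X M S)
  then have "star_tiling P (S \<union> (X \<union> Y)) (add_mset (card S) (M + N))"
    by (intro star_tiling.add) auto
  then show ?case by (simp add: Un_assoc)
qed

lemma star_tiling_split:
  assumes "star_tiling P Y M" "star_tiling P (X - Y) N" "Y \<subseteq> X"
  shows "star_tiling P X (M + N)"
  using star_tiling_union[OF assms(1,2)] assms(3) by (simp add: Un_absorb1)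

text \<open>The case \<open>k = 0\<close> is allowed: \<open>X\<close> is then empty and
  \<open>j\<close> empty tiles arise, which supply the empty classes when there are more colors than
  vertices.\<close>

lemma star_tiling_replicate:
  assumes "finite X" "card X = k * j"
    and "\<And>S. S \<subseteq> X \<Longrightarrow> card S = k \<Longrightarrow> star_like P S"
  shows "star_tiling P X (replicate_mset j k)"
  using assms
proof (induction j arbitrary: X)
  case 0
  then show ?case by (simp add: star_tiling.empty)
next
  case (Suc j)
  obtain S where S: "S \<subseteq> X" "card S = k" "finite S"
    using obtain_subset_with_card_n[of k X] Suc.prems(2) by auto
  have "star_tiling P (X - S) (replicate_mset j k)"
    using Suc.prems S by (intro Suc.IH) (auto simp: card_Diff_subset)
  moreover have "star_tiling P S {#k#}"
    using star_tiling_single[of S P] S Suc.prems(3) by auto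
  ultimately show ?case
    using star_tiling_split[of P S "{#k#}" X] S(1) by auto
qed

lemma star_tiling_within_part:
  assumes "A \<in> P" "X \<subseteq> A" "finite X" "card X = k * j"
  shows "star_tiling P X (replicate_mset j k)"
  using assms by (intro star_tiling_replicate) (auto intro: star_like_subset)

lemma star_tiling_small:
  assumes "X \<subseteq> \<Union>P" "P \<noteq> {}" "finite X" "card X = k * j" "k \<le> 2"
  shows "star_tiling P X (replicate_mset j k)"
  using assms by (intro star_tiling_replicate star_like_card_le_2) (auto intro: finite_subset)

section \<open>From tilings to equitable tree-colorings\<close>

lemma star_tiling_imp_coloring:
  assumes "star_tiling P X M"
  shows "\<exists>f. f \<in> X \<rightarrow> {1..size M} \<and>
    (\<forall>i\<in>{1..size M}. star_like P {v \<in> X. f v = i} \<and> card {v \<in> X. f v = i} \<in># M)"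
  using assms
proof (induction rule: star_tiling.induct)
  case empty
  then show ?case by simp
next
  case (add X M S)
  then obtain f where f: "f \<in> X \<rightarrow> {1..size M}"
    "\<And>i. i \<in> {1..size M} \<Longrightarrow> star_like P {v \<in> X. f v = i} \<and> card {v \<in> X. f v = i} \<in># M"
    by blast
  \<comment> \<open>Tiles are numbered in order of insertion; the new one takes the color just
    beyond the old range.\<close>
  define g where "g v = (if v \<in> S then Suc (size M) else f v)" for v
  have old: "{v \<in> S \<union> X. g v = i} = {v \<in> X. f v = i}" if "i \<in> {1..size M}" for i
    using that add.hyps by (auto simp: g_def)
  have new: "{v \<in> S \<union> X. g v = Suc (size M)} = S"
    using f(1) by (auto simp: g_def Pi_iff)
  have "star_like P {v \<in> S \<union> X. g v = i} \<and>
      card {v \<in> S \<union> X. g v = i} \<in># add_mset (card S) M" if "i \<in> {1..Suc (size M)}" for i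
  proof (cases "i = Suc (size M)")
    case True
    then show ?thesis using new add.hyps by simp
  next
    case False
    then have "i \<in> {1..size M}" using that by auto
    then show ?thesis using f(2)[of i] old[of i] by simp
  qed
  moreover have "g \<in> S \<union> X \<rightarrow> {1..Suc (size M)}"
    using f(1) by (fastforce simp: g_def Pi_iff)
  ultimately show ?case by (intro exI[of _ g]) simp
qed

text \<open>Class sizes in \<open>{q, Suc q}\<close> give equitability, and \<open>q \<le> k\<close>
  bounds them by \<open>Suc k\<close>, as \<open>star_like_component\<close> requires.\<close>

lemma equitable_tree_coloring_of_star_tiling:
  assumes G: "digraph G"
    and indep: "\<And>A e. A \<in> P \<Longrightarrow> e \<in> arcs G \<Longrightarrow> \<not> (tail G e \<in> A \<and> head G e \<in> A)"
    and M: "star_tiling P (verts G) M" "set_mset M \<subseteq> {q, Suc q}" "q \<le> k"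
  shows "\<exists>f. equitable_tree_coloring G (size M) k f"
proof -
  obtain f where f: "f \<in> verts G \<rightarrow> {1..size M}"
    "\<And>i. i \<in> {1..size M} \<Longrightarrow>
      star_like P (color_class G f i) \<and> card (color_class G f i) \<in># M"
    using star_tiling_imp_coloring[OF M(1)] unfolding color_class_def by blast
  have sizes: "card (color_class G f i) \<in> {q, Suc q}" if "i \<in> {1..size M}" for i
    using f(2)[OF that] M(2) by blast
  have "undirected_tree H \<and> (\<forall>v\<in>verts H. out_degree H v \<le> k)"
    if "i \<in> {1..size M}" "connected_component H (G \<restriction> color_class G f i)" for i H
  proof (rule star_like_component[OF G indep _ _ _ that(2)])
    show "star_like P (color_class G f i)" using f(2) that(1) by blast
    show "color_class G f i \<subseteq> verts G" by (auto simp: color_class_def)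
    show "card (color_class G f i) \<le> Suc k" using sizes[OF that(1)] M(3) by auto
  qed
  then have "tree_coloring G (size M) k f"
    using f(1) by (simp add: tree_coloring_def coloring_def)
  moreover have "equitable G (size M) f"
    unfolding equitable_def
  proof (intro ballI)
    fix i j assume "i \<in> {1..size M}" "j \<in> {1..size M}"
    from sizes[OF this(1)] sizes[OF this(2)]
    show "\<bar>int (card (color_class G f i)) - int (card (color_class G f j))\<bar> \<le> 1" by auto
  qed
  ultimately show ?thesis unfolding equitable_tree_coloring_def by blast
qed

subsection \<open>Tiling three disjoint sets of equal size\<close>

lemma star_tiling_insert:
  assumes "A \<in> P" "S \<subseteq> A" "finite S" "c \<notin> S"
  shows "star_tiling P (insert c S) {#Suc (card S)#}"
  using star_tiling_single[of "insert c S" P] star_like_insert[OF assms(1,2)] assms by simp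

locale three_parts =
  fixes P :: "'a set set" and A B C :: "'a set"
  assumes parts: "A \<in> P" "B \<in> P" "C \<in> P"
    and disjoint: "A \<inter> B = {}" "A \<inter> C = {}" "B \<inter> C = {}"
begin

lemma star_tiling_three_within_parts:
  assumes "X \<subseteq> A" "Y \<subseteq> B" "Z \<subseteq> C" "finite X" "finite Y" "finite Z"
    and "card X = k * i" "card Y = k * j" "card Z = k * l"
  shows "star_tiling P (X \<union> Y \<union> Z) (replicate_mset (i + j + l) k)"
proof -
  have "star_tiling P ((X \<union> Y) \<union> Z)
      ((replicate_mset i k + replicate_mset j k) + replicate_mset l k)"
    using assms parts disjoint by (intro star_tiling_union star_tiling_within_part) auto
  moreover have "replicate_mset i k + replicate_mset j k + replicate_mset l k
      = replicate_mset (i + j + l) k"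
    by (intro multiset_eqI) simp
  ultimately show ?thesis by simp
qed

text \<open>Two mixed triples absorb a nonzero residue of \<open>r\<close> modulo 3. The bound on
  \<open>r\<close> excludes \<open>r = 1\<close>, where the only triple would take one vertex from
  each part.\<close>

lemma star_tiling_triples:
  assumes sub: "X \<subseteq> A" "Y \<subseteq> B" "Z \<subseteq> C"
    and fin: "finite X" "finite Y" "finite Z"
    and card: "card X = r" "card Y = r" "card Z = r"
    and r: "r \<ge> 2"
  shows "star_tiling P (X \<union> Y \<union> Z) (replicate_mset r 3)"
proof -
  define p where "p = r div 3"
  consider "r = 3 * p" | "r = 3 * p + 1" | "r = 3 * p + 2"
    unfolding p_def by linarith
  then show ?thesis
  proof cases
    case 1
    moreover have "p + p + p = 3 * p" by simp
    ultimately show ?thesis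
      using star_tiling_three_within_parts[OF sub fin, of 3 p p p] card by metis
  next
    case 2
    then have p: "p \<ge> 1" using r by simp
    \<comment> \<open>\<open>X\<close> and \<open>Y\<close> give up one vertex each, and each of
      these joins its own pair from \<open>Z\<close>. So \<open>Z\<close> loses 4 vertices and keeps
      \<open>3 * (p - 1)\<close>.\<close>
    obtain x y where xy: "x \<in> X" "y \<in> Y" using card r by fastforce
    obtain S where S: "S \<subseteq> Z" "card S = 2" "finite S"
      using obtain_subset_with_card_n[of 2 Z] card r by auto
    have "card (Z - S) \<ge> 2" using card 2 p S by (simp add: card_Diff_subset)
    then obtain T where T: "T \<subseteq> Z - S" "card T = 2" "finite T"
      using obtain_subset_with_card_n[of 2 "Z - S"] by auto
    have dj: "x \<notin> S" "y \<notin> T" "x \<noteq> y" "x \<notin> T" "y \<notin> S" "S \<inter> T = {}"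
      using xy S(1) T(1) sub disjoint by blast+
    have "card (Z - S - T) = 3 * (p - 1)"
      using card 2 p S T by (simp add: card_Diff_subset)
    then have pure: "star_tiling P ((X - {x}) \<union> (Y - {y}) \<union> (Z - S - T))
        (replicate_mset (p + p + (p - 1)) 3)"
      using sub fin card 2 xy by (intro star_tiling_three_within_parts) auto
    have rest: "(X - {x}) \<union> (Y - {y}) \<union> (Z - S - T)
        = X \<union> Y \<union> Z - (insert x S \<union> insert y T)"
      using xy S T sub disjoint by blast
    have mixed: "star_tiling P (insert x S \<union> insert y T) ({#3#} + {#3#})"
    proof (rule star_tiling_union)
      have "S \<subseteq> C" "T \<subseteq> C" using S(1) T(1) sub by blast+
      then show "star_tiling P (insert x S) {#3#}" "star_tiling P (insert y T) {#3#}"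
        using star_tiling_insert[of C P S x] star_tiling_insert[of C P T y] S T dj parts by auto
    qed (use dj in auto)
    have "star_tiling P (X \<union> Y \<union> Z)
        ({#3#} + {#3#} + replicate_mset (p + p + (p - 1)) 3)"
      by (rule star_tiling_split[OF mixed pure[unfolded rest]]) (use xy S T in blast)
    moreover have "{#3#} + {#3#} + replicate_mset (p + p + (p - 1)) 3 = replicate_mset r (3 :: nat)"
      using 2 p by (intro multiset_eqI) auto
    ultimately show ?thesis by (simp only:)
  next
    case 3
    obtain S where S: "S \<subseteq> X" "card S = 2" "finite S"
      using obtain_subset_with_card_n[of 2 X] card r by auto
    obtain T where T: "T \<subseteq> Y" "card T = 2" "finite T"
      using obtain_subset_with_card_n[of 2 Y] card r by auto
    obtain U where U: "U \<subseteq> Z" "card U = 2" "finite U"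
      using obtain_subset_with_card_n[of 2 Z] card r by auto
    \<comment> \<open>The pair from \<open>Z\<close> is split: \<open>x\<close> completes the pair
      from \<open>X\<close> and \<open>y\<close> the pair from \<open>Y\<close>. Each part keeps
      \<open>3 * p\<close> vertices.\<close>
    obtain x y where xy: "U = {x, y}" "x \<noteq> y" using U(2) by (auto simp: card_2_iff)
    then have xyZ: "x \<in> Z" "y \<in> Z" using U(1) by auto
    have dj: "x \<notin> S" "y \<notin> T" "x \<noteq> y" "x \<notin> T" "y \<notin> S" "S \<inter> T = {}"
      using xyZ xy(2) S(1) T(1) sub disjoint by blast+
    have pure: "star_tiling P ((X - S) \<union> (Y - T) \<union> (Z - U)) (replicate_mset (p + p + p) 3)"
      using sub fin card 3 S T U
      by (intro star_tiling_three_within_parts) (auto simp: card_Diff_subset)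
    have rest: "(X - S) \<union> (Y - T) \<union> (Z - U) = X \<union> Y \<union> Z - (insert x S \<union> insert y T)"
      unfolding xy(1) using xyZ S(1) T(1) sub disjoint by blast
    have mixed: "star_tiling P (insert x S \<union> insert y T) ({#3#} + {#3#})"
    proof (rule star_tiling_union)
      have "S \<subseteq> A" "T \<subseteq> B" using S(1) T(1) sub by blast+
      then show "star_tiling P (insert x S) {#3#}" "star_tiling P (insert y T) {#3#}"
        using star_tiling_insert[of A P S x] star_tiling_insert[of B P T y] S T dj parts by auto
    qed (use dj in auto)
    have "star_tiling P (X \<union> Y \<union> Z)
        ({#3#} + {#3#} + replicate_mset (p + p + p) 3)"
      by (rule star_tiling_split[OF mixed pure[unfolded rest]]) (use xyZ S(1) T(1) in blast)
    moreover have "{#3#} + {#3#} + replicate_mset (p + p + p) 3 = replicate_mset r (3 :: nat)"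
      using 3 by (intro multiset_eqI) auto
    ultimately show ?thesis by (simp only:)
  qed
qed

text \<open>After \<open>s\<close> quadruples per part, \<open>n - 4 * s\<close> vertices remain in
  each; the hypothesis makes this at least 2, as \<open>star_tiling_triples\<close> demands.\<close>

lemma star_tiling_4_3:
  assumes fin: "finite A" "finite B" "finite C"
    and card: "card A = n" "card B = n" "card C = n"
    and s: "4 * s + 2 \<le> n"
  shows "star_tiling P (A \<union> B \<union> C) (replicate_mset (3 * s) 4 + replicate_mset (n - 4 * s) 3)"
proof -
  obtain X where X: "X \<subseteq> A" "card X = 4 * s" "finite X"
    using obtain_subset_with_card_n[of "4 * s" A] card s by auto
  obtain Y where Y: "Y \<subseteq> B" "card Y = 4 * s" "finite Y"
    using obtain_subset_with_card_n[of "4 * s" B] card s by auto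
  obtain Z where Z: "Z \<subseteq> C" "card Z = 4 * s" "finite Z"
    using obtain_subset_with_card_n[of "4 * s" C] card s by auto
  have "star_tiling P (X \<union> Y \<union> Z) (replicate_mset (s + s + s) 4)"
    using X Y Z by (intro star_tiling_three_within_parts) auto
  moreover have "star_tiling P ((A - X) \<union> (B - Y) \<union> (C - Z)) (replicate_mset (n - 4 * s) 3)"
    using X Y Z fin card s by (intro star_tiling_triples) (auto simp: card_Diff_subset)
  moreover have "(A - X) \<union> (B - Y) \<union> (C - Z) = A \<union> B \<union> C - (X \<union> Y \<union> Z)"
    using X Y Z disjoint by blast
  moreover have "s + s + s = 3 * s" by simp
  ultimately show ?thesis using X Y Z by (intro star_tiling_split[of P "X \<union> Y \<union> Z"]) auto
qed

text \<open>Only the triples need care: once they all sit inside parts, the remaining vertices may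
  be paired arbitrarily.\<close>

lemma star_tiling_3_2:
  assumes fin: "finite A" "finite B" "finite C"
    and card: "card A = n" "card B = n" "card C = n"
    and P: "\<Union>P = A \<union> B \<union> C"
    and ab: "3 * a + 2 * b = 3 * n" "b > 0"
  shows "star_tiling P (A \<union> B \<union> C) (replicate_mset a 3 + replicate_mset b 2)"
proof -
  \<comment> \<open>Divisibility gives \<open>b = 3 * k\<close> with \<open>k \<ge> 1\<close>, so
    \<open>a = n - 2 * k\<close>. As \<open>n mod 3 \<le> 2\<close>, the parts have room for
    \<open>3 * (n div 3) \<ge> n - 2\<close> triples.\<close>
  have "a + 2 \<le> n"
  proof -
    have "3 dvd 2 * b" using ab(1) by (metis dvd_add_right_iff dvd_triv_left)
    then have "3 dvd b" by presburger
    then obtain k where "b = 3 * k" by blast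
    then show ?thesis using ab by simp
  qed
  then have "a \<le> 3 * (n div 3)" by linarith
  \<comment> \<open>Greedy filling: the first two parts take at most \<open>n div 3\<close> triples
    each, and the bound on \<open>a\<close> lets the rest fit into the third.\<close>
  define i j l where "i = min a (n div 3)" and "j = min (a - i) (n div 3)"
    and "l = a - i - j"
  have ijl: "a = i + j + l" "i \<le> n div 3" "j \<le> n div 3" "l \<le> n div 3"
    using \<open>a \<le> 3 * (n div 3)\<close> unfolding l_def j_def i_def by linarith+
  then have le: "3 * i \<le> n" "3 * j \<le> n" "3 * l \<le> n" by linarith+
  obtain X where X: "X \<subseteq> A" "card X = 3 * i" "finite X"
    using obtain_subset_with_card_n[of "3 * i" A] card le by auto
  obtain Y where Y: "Y \<subseteq> B" "card Y = 3 * j" "finite Y"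
    using obtain_subset_with_card_n[of "3 * j" B] card le by auto
  obtain Z where Z: "Z \<subseteq> C" "card Z = 3 * l" "finite Z"
    using obtain_subset_with_card_n[of "3 * l" C] card le by auto
  have XYZ: "star_tiling P (X \<union> Y \<union> Z) (replicate_mset (i + j + l) 3)"
    using X Y Z by (intro star_tiling_three_within_parts) auto
  have "card (A \<union> B \<union> C) = 3 * n"
    using fin card disjoint by (simp add: card_Un_disjoint Int_Un_distrib2)
  moreover have "card (X \<union> Y \<union> Z) = 3 * a"
  proof -
    have "X \<inter> Y = {}" "(X \<union> Y) \<inter> Z = {}" using X Y Z disjoint by blast+
    then show ?thesis using X Y Z ijl by (simp add: card_Un_disjoint)
  qed
  moreover have "X \<union> Y \<union> Z \<subseteq> A \<union> B \<union> C" using X Y Z by blast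
  ultimately have "card (A \<union> B \<union> C - (X \<union> Y \<union> Z)) = 2 * b"
    using X Y Z ab by (subst card_Diff_subset) auto
  then have "star_tiling P (A \<union> B \<union> C - (X \<union> Y \<union> Z)) (replicate_mset b 2)"
    using fin P parts by (intro star_tiling_small) auto
  then show ?thesis
    using XYZ X Y Z ijl(1) by (intro star_tiling_split[of P "X \<union> Y \<union> Z"]) auto
qed

end

section \<open>Assembly for every number of classes\<close>

lemma star_tiling_2_1:
  assumes "X \<subseteq> \<Union>P" "P \<noteq> {}" "finite X" "card X = Suc q * a + q * b" "q \<le> 1"
  shows "star_tiling P X (replicate_mset a (Suc q) + replicate_mset b q)"
proof -
  obtain Y where Y: "Y \<subseteq> X" "card Y = Suc q * a" "finite Y"
    using obtain_subset_with_card_n[of "Suc q * a" X] assms(4) by auto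
  then have "star_tiling P Y (replicate_mset a (Suc q))"
    using assms by (intro star_tiling_small) auto
  moreover have "star_tiling P (X - Y) (replicate_mset b q)"
    using Y assms by (intro star_tiling_small) (auto simp: card_Diff_subset)
  ultimately show ?thesis using Y(1) by (rule star_tiling_split)
qed

text \<open>With \<open>n = 4 * m - 1\<close>, solving \<open>a + b = t\<close> and
  \<open>Suc q * a + q * b = 3 * n\<close> gives \<open>a = 3 * n - q * t\<close> and
  \<open>b = Suc q * t - 3 * n\<close>. The four cases of the proof are
  \<open>q = 3, 2, 1, 0\<close> with these values.\<close>

lemma (in three_parts) equitable_star_tiling_exists:
  assumes fin: "finite A" "finite B" "finite C"
    and card: "card A = 4 * m - 1" "card B = 4 * m - 1" "card C = 4 * m - 1"
    and P: "\<Union>P = A \<union> B \<union> C" and m: "m > 0" and t: "t \<ge> 3 * m"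
  shows "\<exists>M q. star_tiling P (A \<union> B \<union> C) M \<and> size M = t \<and> set_mset M \<subseteq> {q, Suc q} \<and> q \<le> 3"
proof -
  define n where "n = 4 * m - 1"
  have all: "card (A \<union> B \<union> C) = 3 * n"
    using fin card disjoint by (simp add: card_Un_disjoint Int_Un_distrib2 n_def)
  have ne: "P \<noteq> {}" using parts by auto
  have witness: ?thesis
    if "star_tiling P (A \<union> B \<union> C) (replicate_mset a (Suc q) + replicate_mset b q)"
      "a + b = t" "q \<le> 3" for a b q
    using that
    by (intro exI[of _ "replicate_mset a (Suc q) + replicate_mset b q"] exI[of _ q]) auto
  consider "t \<le> n" | "n < t" "2 * t \<le> 3 * n" | "3 * n < 2 * t" "t \<le> 3 * n" | "3 * n < t"
    by linarith
  then show ?thesis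
  proof cases
    case 1
    \<comment> \<open>Here \<open>t \<ge> 3 * m\<close> enters: \<open>n - t \<le> m - 1\<close>,
      hence \<open>4 * (n - t) \<le> n - 3\<close>.\<close>
    have "4 * (n - t) + 2 \<le> n" using m t 1 by (simp add: n_def)
    then have "star_tiling P (A \<union> B \<union> C)
        (replicate_mset (3 * (n - t)) 4 + replicate_mset (n - 4 * (n - t)) 3)"
      using fin card by (intro star_tiling_4_3) (auto simp: n_def)
    then show ?thesis using \<open>4 * (n - t) + 2 \<le> n\<close> 1
      by (intro witness[of "3 * (n - t)" 3 "n - 4 * (n - t)"]) auto
  next
    case 2
    then have "3 * (3 * n - 2 * t) + 2 * (3 * t - 3 * n) = 3 * n" "3 * t - 3 * n > 0"
      by linarith+
    then have "star_tiling P (A \<union> B \<union> C)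
        (replicate_mset (3 * n - 2 * t) 3 + replicate_mset (3 * t - 3 * n) 2)"
      using fin card P unfolding n_def[symmetric] by (intro star_tiling_3_2)
    then show ?thesis using 2
      by (intro witness[of "3 * n - 2 * t" 2 "3 * t - 3 * n"]) auto
  next
    case 3
    then show ?thesis using fin P ne all
      by (intro witness[of "3 * n - t" 1 "2 * t - 3 * n"] star_tiling_2_1) auto
  next
    case 4
    \<comment> \<open>Every vertex is a class of its own, and the other \<open>t - 3 * n\<close>
      classes are empty.\<close>
    then show ?thesis using fin P ne all
      by (intro witness[of "3 * n" 0 "t - 3 * n"] star_tiling_2_1) auto
  qed
qed

theorem theorem1:
  fixes n :: nat and G :: "('a, 'b) pre_digraph"
  assumes "n > 0" and "[n = 3] (mod 4)"
    and "complete_tripartite_graph n n n G"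
  shows "strong_equitable_vertex_arboricity 3 G \<le> 3 * ((n + 1) div 4)"
proof -
  define m where "m = (n + 1) div 4"
  have "n mod 4 = 3" using assms(2) by (simp add: cong_def)
  \<comment> \<open>The division defining \<open>m\<close> is exact, since 4 divides
    \<open>n + 1\<close>.\<close>
  then have n: "n = 4 * m - 1" and m: "m > 0" unfolding m_def by presburger+
  obtain U V W where graph: "graph G" and verts: "verts G = U \<union> V \<union> W"
    and disj: "U \<inter> V = {}" "U \<inter> W = {}" "V \<inter> W = {}"
    and card: "card U = n" "card V = n" "card W = n"
    and ends: "arcs_ends G = U \<times> V \<union> V \<times> U \<union> U \<times> W \<union> W \<times> U \<union> V \<times> W \<union> W \<times> V"
    using assms(3) unfolding complete_tripartite_graph_def by blast
  interpret graph G by fact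
  interpret three_parts "{U, V, W}" U V W
    using disj by unfold_locales auto
  have indep: "\<not> (tail G e \<in> A \<and> head G e \<in> A)" if "A \<in> {U, V, W}" "e \<in> arcs G" for A e
  proof -
    have "(tail G e, head G e) \<in> arcs_ends G"
      using that(2) by (auto simp: arcs_ends_def arc_to_ends_def)
    then show ?thesis using that(1) disj unfolding ends by blast
  qed
  have fin: "finite U" "finite V" "finite W" using finite_verts unfolding verts by auto
  have "\<exists>f. equitable_tree_coloring G t 3 f" if t: "t \<ge> 3 * m" for t
  proof -
    obtain M q where M: "star_tiling {U, V, W} (verts G) M" "size M = t"
      "set_mset M \<subseteq> {q, Suc q}" "q \<le> 3"
      using equitable_star_tiling_exists[OF fin card[unfolded n] _ m t] unfolding verts by auto
    then show ?thesis
      using equitable_tree_coloring_of_star_tiling[OF digraph_axioms indep M(1,3,4)] by simp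
  qed
  \<comment> \<open>All \<open>t \<ge> 3 * m\<close> admit a coloring, so \<open>3 * m\<close> has
    the property whose least instance defines the arboricity.\<close>
  then show ?thesis
    unfolding strong_equitable_vertex_arboricity_def m_def by (intro Least_le) blast
qed

end
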